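(* For a word $w \in \mathcal{S}'$, let $N_1 = 1$ and construct the pointed, invertible Shimomura sequence associated with the constant sequence $\{ w_n = w : n \in \mathbb{N} \}$. Let $(X,f)$ denote its inverse limit, so that $f \in H(X; 1!)$. \begin{itemize} \item[(a)] If $w = eLeLLe$ or $w = eLLLe$ then $(X,f)$ is topologically mixing. \item[(b)] If $w = eLLe$ or $w = eLeLe$ then $(X,f)$ is not weak mixing. \end{itemize}
   Context: For a finite word $w$ in the letters $e, L$, let $k_w$ be the number of letters $e$ and $K_w$ the number of letters $L$ in $w$, and $\ell_w(x)=k_w+K_wx$. $\mathcal{S}'$ is the set of words that begin and end with $e$ and have $K_w\ge2$. The $1$-$M$ wedge (pointed loop of length $M$) is the relation $\phi_{1-M}=\{(i,i+1):1\le i<M\}\cup\{(1,1),(M,1)\}$ on $[1,M]=\{1,\dots,M\}$. If $m=\ell_w(n)$, the word $w$ defines a map $p_{(w;m,n)}:[1,m]\to[1,n]$: reading $w$ from left to right while moving along $1,2,\dots,m$ starting at $1$, each letter $e$ corresponds to one digit of $[1,m]$, which is mapped to $1$, and each letter $L$ corresponds to the next $n$ consecutive digits of $[1,m]$, which are mapped in order onto $1,2,\dots,n$. Given a sequence $\{w_n\}$ in $\mathcal{S}'$, set $N_1=1$, $N_{n+1}=\ell_{w_n}(N_n)$ and $p_{n+1,n}=p_{(w_n;N_{n+1},N_n)}:([1,N_{n+1}],\phi_{1-N_{n+1}})\to([1,N_n],\phi_{1-N_n})$; each $p_{n+1,n}$ is surjective with $(p_{n+1,n}\times p_{n+1,n})(\phi_{1-N_{n+1}})=\phi_{1-N_n}$.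 The associated Shimomura sequence is $\{p_{n+1,n}\}$, and its inverse limit is $X=\{z\in\prod_n[1,N_n]:z_n=p_{n+1,n}(z_{n+1})\ \forall n\}$ with $f=\{(x,y)\in X\times X:(x_n,y_n)\in\phi_{1-N_n}\ \forall n\}$; $X$ is a Cantor space and $f$ is (the graph of) a homeomorphism of $X$. $H(X;1!)$ is the set of homeomorphisms of $X$ having a unique fixed point and such that $\{f^i(x):i\in\mathbb{Z}\}$ is dense in $X$ for every other point $x$. $f$ is topologically mixing if for all nonempty open $U,V$ there is $N$ with $f^n(U)\cap V\ne\emptyset$ for all $n\ge N$; $f$ is weak mixing if $f\times f$ is topologically transitive on $X\times X$ (for all nonempty open $U,V\subset X\times X$ there is $n\ge1$ with $(f\times f)^n(U)\cap V\ne\emptyset$). *)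

theory Defs
  imports "HOL-Analysis.Analysis"
begin

section \<open>Words and the maps they define\<close>

datatype letter = E | L

text \<open>\<open>E\<close> stands for the letter $e$.\<close>

definition ell :: "letter list \<Rightarrow> nat \<Rightarrow> nat" where
  "ell w x = count_list w E + count_list w L * x"

definition S' :: "letter list set" where
  "S' = {w. w \<noteq> [] \<and> hd w = E \<and> last w = E \<and> count_list w L \<ge> 2}"

definition wedge :: "nat \<Rightarrow> (nat \<times> nat) set" where
  "wedge M = {(i, i + 1) | i. 1 \<le> i \<and> i < M} \<union> {(1, 1), (M, 1)}"

text \<open>The values $p(1), p(2), \dots, p(\ell_w(n))$ of $p_{(w;\ell_w(n),n)}$, in order; the list has
  length \<open>ell w n\<close>.\<close>

definition word_values :: "letter list \<Rightarrow> nat \<Rightarrow> nat list" where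
  "word_values w n = concat (map (\<lambda>c. case c of E \<Rightarrow> [1] | L \<Rightarrow> [1..<Suc n]) w)"

text \<open>\<open>nth\<close> counts from 0, the digits from 1.\<close>

definition word_map :: "letter list \<Rightarrow> nat \<Rightarrow> nat \<Rightarrow> nat" where
  "word_map w n = (\<lambda>i\<in>{1..ell w n}. word_values w n ! (i - 1))"

section \<open>The Shimomura sequence of a sequence of words, and its inverse limit\<close>

text \<open>Levels are indexed from 0 instead of 1: \<open>shim_N ws n\<close> is $N_{n+1}$ and \<open>ws n\<close> is $w_{n+1}$,
  so that \<open>shim_p ws n\<close> maps level \<open>Suc n\<close> to level \<open>n\<close>.\<close>

primrec shim_N :: "(nat \<Rightarrow> letter list) \<Rightarrow> nat \<Rightarrow> nat" where
  "shim_N ws 0 = 1"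
| "shim_N ws (Suc n) = ell (ws n) (shim_N ws n)"

definition shim_p :: "(nat \<Rightarrow> letter list) \<Rightarrow> nat \<Rightarrow> nat \<Rightarrow> nat" where
  "shim_p ws n = word_map (ws n) (shim_N ws n)"

definition shim_space :: "(nat \<Rightarrow> letter list) \<Rightarrow> (nat \<Rightarrow> nat) topology" where
  "shim_space ws =
     subtopology (product_topology (\<lambda>n. discrete_topology {1..shim_N ws n}) UNIV)
       {z. \<forall>n. z n = shim_p ws n (z (Suc n))}"

definition shim_rel :: "(nat \<Rightarrow> letter list) \<Rightarrow> ((nat \<Rightarrow> nat) \<times> (nat \<Rightarrow> nat)) set" where
  "shim_rel ws =
     {(x, y). x \<in> topspace (shim_space ws) \<and> y \<in> topspace (shim_space ws) \<and>
              (\<forall>n. (x n, y n) \<in> wedge (shim_N ws n))}"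

text \<open>The map whose graph is \<open>shim_rel ws\<close>; meaningful when that relation is single-valued and
  total on the space.\<close>

definition shim_map :: "(nat \<Rightarrow> letter list) \<Rightarrow> (nat \<Rightarrow> nat) \<Rightarrow> (nat \<Rightarrow> nat)" where
  "shim_map ws = (\<lambda>x\<in>topspace (shim_space ws). THE y. (x, y) \<in> shim_rel ws)"

section \<open>Topological dynamics\<close>

definition int_iterate :: "'a topology \<Rightarrow> ('a \<Rightarrow> 'a) \<Rightarrow> int \<Rightarrow> 'a \<Rightarrow> 'a" where
  "int_iterate X f i =
     (if i \<ge> 0 then f ^^ nat i else inv_into (topspace X) f ^^ nat (- i))"

text \<open>$H(X;1!)$. Maps of \<open>X\<close> are normalised to be \<open>undefined\<close> outside \<open>topspace X\<close>.\<close>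

definition homeos_one_fixpoint :: "'a topology \<Rightarrow> ('a \<Rightarrow> 'a) set" where
  "homeos_one_fixpoint X =
     {f \<in> extensional (topspace X). homeomorphic_map X X f \<and>
        (\<exists>!x. x \<in> topspace X \<and> f x = x) \<and>
        (\<forall>x\<in>topspace X. f x \<noteq> x \<longrightarrow>
           X closure_of (range (\<lambda>i. int_iterate X f i x)) = topspace X)}"

definition topologically_mixing :: "'a topology \<Rightarrow> ('a \<Rightarrow> 'a) \<Rightarrow> bool" where
  "topologically_mixing X f \<longleftrightarrow>
     (\<forall>U V. openin X U \<and> U \<noteq> {} \<and> openin X V \<and> V \<noteq> {} \<longrightarrow>
        (\<exists>N. \<forall>n\<ge>N. (f ^^ n) ` U \<inter> V \<noteq> {}))"

definition topologically_transitive :: "'a topology \<Rightarrow> ('a \<Rightarrow> 'a) \<Rightarrow> bool" where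
  "topologically_transitive X f \<longleftrightarrow>
     (\<forall>U V. openin X U \<and> U \<noteq> {} \<and> openin X V \<and> V \<noteq> {} \<longrightarrow>
        (\<exists>n\<ge>1. (f ^^ n) ` U \<inter> V \<noteq> {}))"

definition weak_mixing :: "'a topology \<Rightarrow> ('a \<Rightarrow> 'a) \<Rightarrow> bool" where
  "weak_mixing X f \<longleftrightarrow> topologically_transitive (prod_topology X X) (map_prod f f)"

end

theory Submission
  imports Defs
begin

text \<open>A point of the limit is a compatible choice of a vertex in each wedge, and the homeomorphism
  moves along all loops at once. The only branching in a wedge is at the base point 1, whose
  successors are 1 and 2 and whose predecessors are 1 and the last vertex. Because a word of \<open>S'\<close>
  begins and ends with \<open>e\<close>, the bonding map sends 1, 2 and the last vertex all to 1. So it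
  forgets the branching, the vertex at level \<open>Suc n\<close> determines the next and the previous vertex at
  level \<open>n\<close>, and both the relation and its converse are graphs of continuous maps. The constant
  point 1 is the only fixed point. Any other point lies off the base point at all high levels, where
  its orbit runs through the entire loop; the cylinders over single vertices form a basis, so the
  orbit is dense.

  For the mixing properties, a vertex other than 1 tells where in a loop a point is, and the vertex 2
  marks a passage through the loop. Let \<open>D n\<close> be the set of times between two passages through 2 at
  level \<open>n\<close>. If \<open>D n\<close> contains all large times for each \<open>n\<close>, the system is mixing. One
  passage at level \<open>Suc n\<close> contains one passage at level \<open>n\<close> for each letter \<open>L\<close>, so \<open>D n\<close> contains
  \<open>k + d - c\<close> for each \<open>k\<close> in \<open>D (Suc n)\<close> and each two offsets \<open>c\<close>, \<open>d\<close> of letters \<open>L\<close> in the word.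
  Write \<open>N\<close> for the length of the loop at level \<open>n\<close>. For \<open>eLeLLe\<close> the offsets are \<open>1\<close>, \<open>N + 2\<close>,
  \<open>2 * N + 2\<close> and the next loop has length \<open>3 * N + 3\<close>. Differences of offsets give \<open>N\<close> and \<open>N + 1\<close>
  directly, and going from the last \<open>L\<close> of one loop to the first \<open>L\<close> of a later one turns
  \<open>(3 * N + 3) + t\<close> into \<open>N + (t + 2)\<close>; hence \<open>D n\<close> contains all times from \<open>N\<close> on. For \<open>eLLLe\<close> the
  same argument gives the times \<open>N + 2 * s\<close>, and the odd length of the loops lets a shift by \<open>N\<close>
  reach the times of the other parity.

  For \<open>eLLe\<close> and \<open>eLeLe\<close> the offsets of the two letters \<open>L\<close> differ by an even number at each level from 1
  on. So the parity of a vertex that projects away from 1 is the opposite of that of its projection,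
  and the time between vertices \<open>a\<close> and \<open>b\<close> at level 1, both other than 1, has the parity of
  \<open>b - a\<close>. Thus no time takes vertex 2 back to 2 and also vertex 2 to 3, which weak mixing would
  require.\<close>

section \<open>Inverse limits of finite discrete sets\<close>

text \<open>The compatibility equations are oriented towards the lower level, so that they terminate as
  rewrite rules.\<close>

definition inv_limit :: "(nat \<Rightarrow> 'a set) \<Rightarrow> (nat \<Rightarrow> 'a \<Rightarrow> 'a) \<Rightarrow> (nat \<Rightarrow> 'a) topology" where
  "inv_limit V p =
     subtopology (product_topology (\<lambda>n. discrete_topology (V n)) UNIV) {z. \<forall>n. p n (z (Suc n)) = z n}"

lemma topspace_inv_limit:
  "topspace (inv_limit V p) = {z. (\<forall>n. z n \<in> V n) \<and> (\<forall>n. p n (z (Suc n)) = z n)}"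
  by (auto simp: inv_limit_def PiE_UNIV_domain)

lemma inv_limit_coordinates_below:
  assumes "x \<in> topspace (inv_limit V p)" "y \<in> topspace (inv_limit V p)" "x n = y n" "i \<le> n"
  shows "x i = y i"
  using assms(4)
proof (induction i rule: inc_induct)
  case (step i)
  moreover have "p i (x (Suc i)) = x i" "p i (y (Suc i)) = y i"
    using assms(1,2) by (simp_all add: topspace_inv_limit)
  ultimately show ?case by simp
qed (use assms(3) in simp)

lemma openin_cylinder:
  "openin (inv_limit V p) {z \<in> topspace (inv_limit V p). z n = a}"
proof -
  have "continuous_map (inv_limit V p) (discrete_topology (V n)) (\<lambda>z. z n)"
    unfolding inv_limit_def
    by (intro continuous_map_from_subtopology continuous_map_product_projection) simp
  then have "openin (inv_limit V p) {z \<in> topspace (inv_limit V p). z n \<in> V n \<inter> {a}}"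
    by (rule openin_continuous_map_preimage) simp
  also have "{z \<in> topspace (inv_limit V p). z n \<in> V n \<inter> {a}} =
             {z \<in> topspace (inv_limit V p). z n = a}"
    by (auto simp: topspace_inv_limit)
  finally show ?thesis .
qed

text \<open>A basic open set of the product constrains finitely many coordinates, and all of these are
  functions of any later one.\<close>

lemma cylinder_within_open:
  assumes U: "openin (inv_limit V p) U" and x: "x \<in> U"
  obtains n where "m \<le> n" and "{z \<in> topspace (inv_limit V p). z n = x n} \<subseteq> U"
proof -
  obtain T where T: "openin (product_topology (\<lambda>n. discrete_topology (V n)) UNIV) T"
      and UT: "U = T \<inter> {z. \<forall>n. p n (z (Suc n)) = z n}"
    using U unfolding inv_limit_def openin_subtopology by blast
  obtain B where fin: "finite {i. B i \<noteq> V i}" and xB: "x \<in> Pi\<^sub>E UNIV B" and BT: "Pi\<^sub>E UNIV B \<subseteq> T"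
    using T x UT unfolding openin_product_topology_alt by fastforce
  \<comment> \<open>Including \<open>m\<close> lets the caller ask for an arbitrarily high level.\<close>
  define n where "n = Max (insert m {i. B i \<noteq> V i})"
  have xX: "x \<in> topspace (inv_limit V p)"
    using openin_subset[OF U] x by blast
  have "z \<in> U" if z: "z \<in> topspace (inv_limit V p)" "z n = x n" for z
  proof -
    have "z i \<in> B i" for i
    proof (cases "B i = V i")
      case True
      then show ?thesis using z(1) by (simp add: topspace_inv_limit)
    next
      case False
      then have "i \<le> n" unfolding n_def using fin by (intro Max_ge) auto
      then have "z i = x i" using inv_limit_coordinates_below[OF z(1) xX z(2)] by simp
      then show ?thesis using xB by (auto simp: PiE_UNIV_domain)
    qed
    then have "z \<in> T" using BT by (auto simp: PiE_UNIV_domain)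
    then show ?thesis using z(1) UT by (simp add: topspace_inv_limit)
  qed
  moreover have "m \<le> n" unfolding n_def using fin by (intro Max_ge) auto
  ultimately show ?thesis using that by blast
qed

text \<open>Above the given vertex, preimages are chosen one level at a time; below it, the bonding maps
  determine the coordinates.\<close>

lemma inv_limit_through_vertex:
  assumes surj: "\<And>n. p n ` V (Suc n) = V n" and a: "a \<in> V n"
  obtains z where "z \<in> topspace (inv_limit V p)" and "z n = a"
proof -
  have "\<exists>r. \<forall>k. (r k \<in> V (n + k) \<and> (k = 0 \<longrightarrow> r k = a)) \<and> p (n + k) (r (Suc k)) = r k"
  proof (rule dependent_nat_choice)
    fix b k assume "b \<in> V (n + k) \<and> (k = 0 \<longrightarrow> b = a)"
    then have "b \<in> p (n + k) ` V (n + Suc k)"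
      using surj[of "n + k"] by simp
    then show "\<exists>y. (y \<in> V (n + Suc k) \<and> (Suc k = 0 \<longrightarrow> y = a)) \<and> p (n + k) y = b"
      by auto
  qed (use a in auto)
  then obtain r where r: "\<And>k. r k \<in> V (n + k)" "r 0 = a" "\<And>k. p (n + k) (r (Suc k)) = r k"
    by blast
  \<comment> \<open>Below level \<open>n\<close> the subtraction truncates and \<open>z0\<close> is constantly \<open>a\<close>; \<open>extend\<close> corrects these
    values.\<close>
  define z0 where "z0 = (\<lambda>k. r (k - n))"
  have extend: "\<exists>z'. (\<forall>k. z' k \<in> V k \<and> p k (z' (Suc k)) = z' k) \<and> (\<forall>k\<ge>l. z' k = z k)"
    if "\<forall>k\<ge>l. z k \<in> V k \<and> p k (z (Suc k)) = z k" for l and z :: "nat \<Rightarrow> 'a"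
    using that
  proof (induction l arbitrary: z)
    case (Suc l)
    define y where "y = z(l := p l (z (Suc l)))"
    have "\<forall>k\<ge>l. y k \<in> V k \<and> p k (y (Suc k)) = y k"
    proof (intro allI impI)
      fix k assume "l \<le> k"
      then show "y k \<in> V k \<and> p k (y (Suc k)) = y k"
        using Suc.prems surj[of l] by (cases "k = l") (auto simp: y_def)
    qed
    from Suc.IH[OF this] obtain z' where "\<forall>k. z' k \<in> V k \<and> p k (z' (Suc k)) = z' k" "\<forall>k\<ge>l. z' k = y k"
      by blast
    then show ?case
      by (intro exI[of _ z']) (auto simp: y_def)
  qed auto
  have "\<forall>k\<ge>n. z0 k \<in> V k \<and> p k (z0 (Suc k)) = z0 k"
  proof (intro allI impI)
    fix k assume "n \<le> k"
    then show "z0 k \<in> V k \<and> p k (z0 (Suc k)) = z0 k"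
      using r(1)[of "k - n"] r(3)[of "k - n"] by (simp add: z0_def Suc_diff_le)
  qed
  from extend[OF this] obtain z' where "\<forall>k. z' k \<in> V k \<and> p k (z' (Suc k)) = z' k" "\<forall>k\<ge>n. z' k = z0 k"
    by blast
  with that[of z'] r(2) show ?thesis
    by (auto simp: topspace_inv_limit z0_def)
qed

text \<open>The bonding maps forget which successor was chosen, so the \<open>n\<close>-th coordinate of the successor
  of \<open>x\<close> must be the image of any successor of the coordinate at level \<open>Suc n\<close>. This formula gives a
  point of the limit, and it shows the continuity as well, since it reads a single coordinate.\<close>

lemma directional_relation_is_graph:
  assumes sub: "\<And>n i j. (i, j) \<in> R n \<Longrightarrow> i \<in> V n \<and> j \<in> V n"
    and total: "\<And>n i. i \<in> V n \<Longrightarrow> \<exists>j. (i, j) \<in> R n"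
    and pres: "\<And>n i j. (i, j) \<in> R (Suc n) \<Longrightarrow> (p n i, p n j) \<in> R n"
    and forget: "\<And>n i j j'. (i, j) \<in> R (Suc n) \<Longrightarrow> (i, j') \<in> R (Suc n) \<Longrightarrow> p n j = p n j'"
  shows "\<exists>F. continuous_map (inv_limit V p) (inv_limit V p) F \<and>
             (\<forall>x\<in>topspace (inv_limit V p). \<forall>y\<in>topspace (inv_limit V p).
                (\<forall>n. (x n, y n) \<in> R n) \<longleftrightarrow> y = F x)"
proof -
  let ?X = "inv_limit V p"
  define s where "s n i = (SOME j. (i, j) \<in> R n)" for n i
  have s: "(i, s n i) \<in> R n" if "i \<in> V n" for n i
    unfolding s_def using total[OF that] by (rule someI_ex)
  define F where "F = (\<lambda>x n. p n (s (Suc n) (x (Suc n))))"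
  have rel: "(x n, F x n) \<in> R n" if "x \<in> topspace ?X" for x n
    using pres[OF s, of "x (Suc n)" n] that by (simp add: topspace_inv_limit F_def)
  have F_in: "F x \<in> topspace ?X" if x: "x \<in> topspace ?X" for x
  proof -
    have "p n (F x (Suc n)) = F x n" for n
      using forget[OF s rel[OF x], of n] x by (simp add: F_def topspace_inv_limit)
    moreover have "F x n \<in> V n" for n
      using sub[OF rel[OF x]] by blast
    ultimately show ?thesis by (simp add: topspace_inv_limit)
  qed
  have unique: "y = F x"
    if x: "x \<in> topspace ?X" and y: "y \<in> topspace ?X" and xy: "\<forall>n. (x n, y n) \<in> R n" for x y
  proof
    fix n
    have "y n = p n (y (Suc n))" using y by (simp add: topspace_inv_limit)
    also have "\<dots> = p n (F x (Suc n))" using xy rel[OF x] by (intro forget) auto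
    also have "\<dots> = F x n" using F_in[OF x] by (simp add: topspace_inv_limit)
    finally show "y n = F x n" .
  qed
  have "continuous_map ?X (discrete_topology (V n)) (\<lambda>x. F x n)" for n
  proof -
    have "continuous_map ?X (discrete_topology (V (Suc n))) (\<lambda>x. x (Suc n))"
      unfolding inv_limit_def
      by (intro continuous_map_from_subtopology continuous_map_product_projection) simp
    moreover have "continuous_map (discrete_topology (V (Suc n))) (discrete_topology (V n))
        (\<lambda>i. p n (s (Suc n) i))"
      using sub pres s by (fastforce simp: Pi_iff)
    ultimately have "continuous_map ?X (discrete_topology (V n))
        ((\<lambda>i. p n (s (Suc n) i)) \<circ> (\<lambda>x. x (Suc n)))"
      by (rule continuous_map_compose)
    then show ?thesis by (simp add: F_def o_def)
  qed
  then have "continuous_map ?X (product_topology (\<lambda>n. discrete_topology (V n)) UNIV) F"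
    by (simp add: continuous_map_componentwise_UNIV)
  moreover have "F x \<in> {z. \<forall>n. p n (z (Suc n)) = z n}" if "x \<in> topspace ?X" for x
    using F_in[OF that] by (simp add: topspace_inv_limit)
  ultimately have "continuous_map ?X ?X F"
    by (subst (2) inv_limit_def) (auto simp: continuous_map_in_subtopology)
  with unique rel show ?thesis by blast
qed

section \<open>The bonding map of a word\<close>

lemma word_values_Cons:
  "word_values (c # w) n = (case c of E \<Rightarrow> [1] | L \<Rightarrow> [1..<Suc n]) @ word_values w n"
  by (simp add: word_values_def)

lemma length_word_values: "length (word_values w n) = ell w n"
  by (induction w) (auto simp: word_values_Cons ell_def word_values_def split: letter.splits)

lemma word_values_neq_Nil: "1 \<le> n \<Longrightarrow> w \<noteq> [] \<Longrightarrow> word_values w n \<noteq> []"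
  by (cases w) (auto simp: word_values_Cons split: letter.splits)

lemma hd_word_values: "1 \<le> n \<Longrightarrow> w \<noteq> [] \<Longrightarrow> hd (word_values w n) = 1"
  by (cases w) (auto simp: word_values_Cons hd_append upt_conv_Cons simp del: upt_Suc split: letter.splits)

lemma set_word_values_subset: "1 \<le> n \<Longrightarrow> set (word_values w n) \<subseteq> {1..n}"
  by (induction w) (auto simp: word_values_Cons word_values_def split: letter.splits)

lemma subset_set_word_values: "L \<in> set w \<Longrightarrow> {1..n} \<subseteq> set (word_values w n)"
  by (force simp: word_values_def)

text \<open>Within the image of one letter the digits increase by one, and each such image begins at 1 and
  ends at 1 or \<open>n\<close>, from where the wedge allows the return to 1.\<close>

lemma successively_word_values:
  assumes "1 \<le> n"
  shows "successively (\<lambda>i j. (i, j) \<in> wedge n) (word_values w n)"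
proof (induction w)
  case (Cons c w)
  let ?b = "case c of E \<Rightarrow> [1] | L \<Rightarrow> [1..<Suc n]"
  have b: "successively (\<lambda>i j. (i, j) \<in> wedge n) ?b" "last ?b \<in> {1, n}"
    using assms
    by (auto simp: successively_conv_nth wedge_def simp del: upt_Suc split: letter.splits)
  have "(last ?b, hd (word_values w n)) \<in> wedge n" if "word_values w n \<noteq> []"
  proof -
    have "w \<noteq> []" using that by (auto simp: word_values_def)
    then show ?thesis using hd_word_values[OF assms] b(2) by (auto simp: wedge_def)
  qed
  then show ?case
    unfolding word_values_Cons successively_append_iff using b(1) Cons.IH by blast
qed (simp add: word_values_def)

lemma wedge_in_range: "1 \<le> M \<Longrightarrow> (i, j) \<in> wedge M \<Longrightarrow> i \<in> {1..M} \<and> j \<in> {1..M}"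
  by (auto simp: wedge_def)

lemma wedge_forward: "(i, j) \<in> wedge M \<Longrightarrow> i \<noteq> 1 \<Longrightarrow> i < M \<Longrightarrow> j = Suc i"
  by (auto simp: wedge_def)

lemma wedge_backward: "(i, j) \<in> wedge M \<Longrightarrow> j \<noteq> 1 \<Longrightarrow> j = Suc i"
  by (auto simp: wedge_def)

lemma ell_ge: "w \<in> S' \<Longrightarrow> 2 * n + 2 \<le> ell w n"
proof -
  assume w: "w \<in> S'"
  then obtain v where v: "w = E # v" "v \<noteq> []" "last v = E"
    by (cases w) (auto simp: S'_def split: if_splits)
  then obtain u where "v = u @ [E]"
    by (metis append_butlast_last_id)
  with v have "2 \<le> count_list w E" by simp
  moreover have "2 * n \<le> count_list w L * n"
    using w unfolding S'_def by (intro mult_le_mono1) simp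
  ultimately show ?thesis unfolding ell_def by linarith
qed

text \<open>The first two digits and the last one go to 1: the second because each letter starts at 1.
  This makes the map forget the branching of the wedge at 1, both forward and backward.\<close>

lemma word_map_1:
  assumes w: "w \<in> S'" and n: "1 \<le> n"
  shows "word_map w n 1 = 1" "word_map w n 2 = 1" "word_map w n (ell w n) = 1"
proof -
  obtain v where v: "w = E # v" "v \<noteq> []" "last v = E"
    using w by (cases w) (auto simp: S'_def split: if_splits)
  then obtain u where u: "v = u @ [E]"
    by (metis append_butlast_last_id)
  have val: "word_values w n = 1 # word_values v n"
    by (simp add: v word_values_Cons)
  have ell: "4 \<le> ell w n" using ell_ge[OF w, of n] n by simp
  then show "word_map w n 1 = 1" by (simp add: word_map_def val)
  have "word_values v n ! 0 = 1"
    using hd_word_values[OF n v(2)] word_values_neq_Nil[OF n v(2)] by (simp add: hd_conv_nth)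
  then show "word_map w n 2 = 1" using ell by (simp add: word_map_def val)
  have "word_values w n ! (ell w n - 1) = last (word_values w n)"
    using ell by (subst last_conv_nth) (auto simp: length_word_values simp flip: length_greater_0_conv)
  also have "\<dots> = 1" by (simp add: v(1) u word_values_def)
  finally show "word_map w n (ell w n) = 1" using ell by (simp add: word_map_def)
qed

lemma word_map_wedge:
  assumes w: "w \<in> S'" and n: "1 \<le> n" and ij: "(i, j) \<in> wedge (ell w n)"
  shows "(word_map w n i, word_map w n j) \<in> wedge n"
proof -
  have "i < ell w n \<and> 1 \<le> i \<and> j = Suc i \<or> i = 1 \<and> j = 1 \<or> i = ell w n \<and> j = 1"
    using ij by (auto simp: wedge_def)
  then show ?thesis
  proof (elim disjE)
    assume i: "i < ell w n \<and> 1 \<le> i \<and> j = Suc i"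
    then have "(word_values w n ! (i - 1), word_values w n ! Suc (i - 1)) \<in> wedge n"
      by (intro successively_nth[OF successively_word_values[OF n]]) (auto simp: length_word_values)
    then show ?thesis using i by (simp add: word_map_def)
  next
    assume "i = 1 \<and> j = 1"
    then show ?thesis using word_map_1(1)[OF w n] by (simp add: wedge_def)
  next
    assume "i = ell w n \<and> j = 1"
    then show ?thesis using word_map_1(1,3)[OF w n] by (simp add: wedge_def)
  qed
qed

lemma word_map_surj:
  assumes w: "w \<in> S'" and n: "1 \<le> n"
  shows "word_map w n ` {1..ell w n} = {1..n}"
proof -
  have "word_map w n ` {1..ell w n} = (\<lambda>i. word_values w n ! (i - 1)) ` Suc ` {..<ell w n}"
    by (simp add: word_map_def image_Suc_lessThan)
  also have "\<dots> = set (word_values w n)"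
    unfolding set_conv_nth length_word_values image_image by auto
  also have "\<dots> = {1..n}"
  proof -
    have "L \<in> set w" using w by (metis (mono_tags) S'_def count_list_0_iff mem_Collect_eq not_numeral_le_zero)
    then show ?thesis using set_word_values_subset[OF n] subset_set_word_values by blast
  qed
  finally show ?thesis .
qed

lemma word_map_forgets_successor:
  assumes w: "w \<in> S'" and n: "1 \<le> n" and "(i, j) \<in> wedge (ell w n)" "(i, j') \<in> wedge (ell w n)"
  shows "word_map w n j = word_map w n j'"
proof -
  have "j = j' \<or> {j, j'} \<subseteq> {1, 2}" using assms(3,4) by (auto simp: wedge_def)
  then show ?thesis using word_map_1[OF w n] by auto
qed

lemma word_map_forgets_predecessor:
  assumes w: "w \<in> S'" and n: "1 \<le> n" and "(j, i) \<in> wedge (ell w n)" "(j', i) \<in> wedge (ell w n)"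
  shows "word_map w n j = word_map w n j'"
proof -
  have "j = j' \<or> {j, j'} \<subseteq> {1, ell w n}" using assms(3,4) by (auto simp: wedge_def)
  then show ?thesis using word_map_1[OF w n] by auto
qed

section \<open>The limit homeomorphism\<close>

locale word_sequence =
  fixes ws :: "nat \<Rightarrow> letter list"
  assumes ws: "ws n \<in> S'"
begin

abbreviation N where "N \<equiv> shim_N ws"
abbreviation p where "p \<equiv> shim_p ws"
abbreviation X where "X \<equiv> shim_space ws"
abbreviation f where "f \<equiv> shim_map ws"

lemma X_inv_limit: "X = inv_limit (\<lambda>n. {1..N n}) p"
  unfolding shim_space_def inv_limit_def
  by (intro arg_cong[where f = "subtopology _"] Collect_cong all_cong1 eq_commute)

lemmas X_openin_cylinder = openin_cylinder[of "\<lambda>n. {1..N n}" p, folded X_inv_limit]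
  and X_cylinder_within_open = cylinder_within_open[of "\<lambda>n. {1..N n}" p, folded X_inv_limit]
  and X_coordinates_below = inv_limit_coordinates_below[of _ "\<lambda>n. {1..N n}" p, folded X_inv_limit]

lemma N_pos: "1 \<le> N n"
proof (cases n)
  case (Suc m)
  then show ?thesis using ell_ge[OF ws, of "N m" m] by simp
qed simp

lemma N_ge: "1 \<le> n \<Longrightarrow> 4 \<le> N n"
proof (cases n)
  case (Suc m)
  then show ?thesis using ell_ge[OF ws, of "N m" m] N_pos[of m] by simp
qed simp

lemma in_X: "x \<in> topspace X \<longleftrightarrow> (\<forall>n. 1 \<le> x n \<and> x n \<le> N n) \<and> (\<forall>n. p n (x (Suc n)) = x n)"
  by (simp add: X_inv_limit topspace_inv_limit)

lemma p_1: "p n 1 = 1"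
  unfolding shim_p_def by (rule word_map_1(1)[OF ws N_pos])

lemma point_through_vertex:
  assumes "1 \<le> a" "a \<le> N n"
  obtains z where "z \<in> topspace X" "z n = a"
proof -
  have "p m ` {1..N (Suc m)} = {1..N m}" for m
    using word_map_surj[OF ws N_pos] by (simp add: shim_p_def)
  from inv_limit_through_vertex[of p "\<lambda>n. {1..N n}" a n, OF this] assms
  obtain z where "z \<in> topspace X" "z n = a" unfolding X_inv_limit by auto
  then show ?thesis by (rule that)
qed

text \<open>The relation and its converse are both directional, so both are graphs of continuous maps,
  which then invert each other.\<close>

lemma shim_rel_graph_of_homeomorphism:
  "homeomorphic_map X X f \<and>
   (\<forall>x\<in>topspace X. \<forall>y\<in>topspace X. (x, y) \<in> shim_rel ws \<longleftrightarrow> y = f x)"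
proof -
  let ?V = "\<lambda>n. {1..N n}"
  have "\<exists>F. continuous_map (inv_limit ?V p) (inv_limit ?V p) F \<and>
             (\<forall>x\<in>topspace (inv_limit ?V p). \<forall>y\<in>topspace (inv_limit ?V p).
                (\<forall>n. (x n, y n) \<in> wedge (N n)) \<longleftrightarrow> y = F x)"
  proof (rule directional_relation_is_graph[where R = "\<lambda>n. wedge (N n)"])
    fix n i j j'
    show "i \<in> ?V n \<and> j \<in> ?V n" if "(i, j) \<in> wedge (N n)"
      using wedge_in_range[OF N_pos that] .
    show "\<exists>j. (i, j) \<in> wedge (N n)" if "i \<in> ?V n"
      using that by (cases "i = N n") (auto simp: wedge_def)
    show "(p n i, p n j) \<in> wedge (N n)" if "(i, j) \<in> wedge (N (Suc n))"
      using word_map_wedge[OF ws N_pos, of i j n n] that by (simp add: shim_p_def)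
    show "p n j = p n j'" if "(i, j) \<in> wedge (N (Suc n))" "(i, j') \<in> wedge (N (Suc n))"
      unfolding shim_p_def by (rule word_map_forgets_successor[OF ws N_pos]) (use that in simp_all)
  qed
  then obtain F where F: "continuous_map X X F"
      "\<And>x y. x \<in> topspace X \<Longrightarrow> y \<in> topspace X \<Longrightarrow> (x, y) \<in> shim_rel ws \<longleftrightarrow> y = F x"
    unfolding X_inv_limit shim_rel_def by blast
  have "\<exists>G. continuous_map (inv_limit ?V p) (inv_limit ?V p) G \<and>
             (\<forall>x\<in>topspace (inv_limit ?V p). \<forall>y\<in>topspace (inv_limit ?V p).
                (\<forall>n. (x n, y n) \<in> (wedge (N n))\<inverse>) \<longleftrightarrow> y = G x)"
  proof (rule directional_relation_is_graph[where R = "\<lambda>n. (wedge (N n))\<inverse>"])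
    fix n i j j'
    show "i \<in> ?V n \<and> j \<in> ?V n" if "(i, j) \<in> (wedge (N n))\<inverse>"
      using wedge_in_range[OF N_pos, of j i n] that by blast
    show "\<exists>j. (i, j) \<in> (wedge (N n))\<inverse>" if "i \<in> ?V n"
    proof (cases "i = 1")
      case False
      then have "(i - 1, i) \<in> wedge (N n)" using that by (auto simp: wedge_def)
      then show ?thesis by blast
    qed (auto simp: wedge_def)
    show "(p n i, p n j) \<in> (wedge (N n))\<inverse>" if "(i, j) \<in> (wedge (N (Suc n)))\<inverse>"
      using word_map_wedge[OF ws N_pos, of j i n n] that by (simp add: shim_p_def)
    show "p n j = p n j'" if "(i, j) \<in> (wedge (N (Suc n)))\<inverse>" "(i, j') \<in> (wedge (N (Suc n)))\<inverse>"
      unfolding shim_p_def by (rule word_map_forgets_predecessor[OF ws N_pos]) (use that in simp_all)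
  qed
  then obtain G where G: "continuous_map X X G"
      "\<And>x y. x \<in> topspace X \<Longrightarrow> y \<in> topspace X \<Longrightarrow> (y, x) \<in> shim_rel ws \<longleftrightarrow> y = G x"
    unfolding X_inv_limit shim_rel_def converse_iff by blast
  have FG_in: "F x \<in> topspace X" "G x \<in> topspace X" if "x \<in> topspace X" for x
    using continuous_map_funspace[OF F(1)] continuous_map_funspace[OF G(1)] that by blast+
  have f: "f x = F x" if "x \<in> topspace X" for x
  proof -
    have "(THE y. (x, y) \<in> shim_rel ws) = F x"
      using F(2)[OF that] FG_in that by (intro the_equality) (auto simp: shim_rel_def)
    then show ?thesis using that by (simp add: shim_map_def)
  qed
  have "homeomorphic_maps X X F G"
    unfolding homeomorphic_maps_def
  proof (intro conjI ballI)
    fix x assume x: "x \<in> topspace X"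
    show "G (F x) = x" using F(2)[OF x FG_in(1)[OF x]] G(2)[OF FG_in(1)[OF x] x] by simp
    show "F (G x) = x" using G(2)[OF x FG_in(2)[OF x]] F(2)[OF FG_in(2)[OF x] x] by simp
  qed (fact F(1) G(1))+
  then have "homeomorphic_maps X X f G"
    by (rule homeomorphic_maps_eq) (auto simp: f)
  then show ?thesis using F(2) f by (auto simp: homeomorphic_maps_map)
qed

lemmas homeomorphic_f = shim_rel_graph_of_homeomorphism[THEN conjunct1]

lemma f_in [simp]: "x \<in> topspace X \<Longrightarrow> f x \<in> topspace X"
  using homeomorphic_imp_surjective_map[OF homeomorphic_f] by blast

lemma shim_rel_iff: "(x, y) \<in> shim_rel ws \<longleftrightarrow> x \<in> topspace X \<and> y = f x"
proof -
  have "(x, y) \<in> shim_rel ws \<Longrightarrow> x \<in> topspace X \<and> y \<in> topspace X"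
    by (simp add: shim_rel_def)
  then show ?thesis
    using shim_rel_graph_of_homeomorphism f_in by blast
qed

lemma funpow_f_in [simp]: "x \<in> topspace X \<Longrightarrow> (f ^^ k) x \<in> topspace X"
  by (induction k) auto

lemma f_wedge: "x \<in> topspace X \<Longrightarrow> (x n, f x n) \<in> wedge (N n)"
  using shim_rel_iff[of x "f x"] by (simp add: shim_rel_def)

lemma bij_betw_f: "bij_betw f (topspace X) (topspace X)"
  unfolding bij_betw_def
  using homeomorphic_f homeomorphic_imp_injective_map homeomorphic_imp_surjective_map by blast

text \<open>A loop is traversed one vertex at a time.\<close>

lemma funpow_f_coordinate:
  assumes "x \<in> topspace X" "2 \<le> x n" "x n + k \<le> N n"
  shows "(f ^^ k) x n = x n + k"
  using assms(3)
proof (induction k)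
  case (Suc k)
  then have "(f ^^ k) x n = x n + k" by simp
  then show ?case
    using wedge_forward[OF f_wedge[OF funpow_f_in[OF assms(1), of k], of n]] assms(2) Suc.prems
    by simp
qed simp

abbreviation f_inv where "f_inv \<equiv> inv_into (topspace X) f"

lemma funpow_f_inv_coordinate:
  assumes "x \<in> topspace X" "k < x n"
  shows "(f_inv ^^ k) x \<in> topspace X \<and> (f_inv ^^ k) x n = x n - k"
  using assms(2)
proof (induction k)
  case (Suc k)
  let ?y = "(f_inv ^^ k) x"
  have y: "?y \<in> topspace X" "?y n = x n - k" using Suc by auto
  have "f_inv ?y \<in> topspace X" "f (f_inv ?y) = ?y"
    using bij_betw_f y(1) by (auto simp: bij_betw_def f_inv_into_f intro: inv_into_into)
  then show ?case
    using f_wedge[of "f_inv ?y" n] y(2) Suc.prems by (auto simp: wedge_def)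
qed (use assms in simp)

lemma const_1_in: "(\<lambda>_. 1) \<in> topspace X"
  using N_pos p_1 by (simp add: in_X)

lemma f_fixed_iff:
  assumes x: "x \<in> topspace X"
  shows "f x = x \<longleftrightarrow> x = (\<lambda>_. 1)"
proof
  assume fx: "f x = x"
  have "x n = 1" for n
    using wedge_backward[OF f_wedge[OF x, of n]] fx by auto
  then show "x = (\<lambda>_. 1)" by blast
next
  assume x1: "x = (\<lambda>_. 1)"
  have "((\<lambda>_. 1), (\<lambda>_. 1)) \<in> shim_rel ws"
    using const_1_in by (simp add: shim_rel_def wedge_def)
  then show "f x = x" unfolding x1 shim_rel_iff by simp
qed

lemma neq_1_above:
  assumes "x \<in> topspace X" "x m \<noteq> 1" "m \<le> n"
  shows "x n \<noteq> 1"
  using assms(3)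
proof (induction n rule: dec_induct)
  case (step n)
  moreover have "p n (x (Suc n)) = x n" using assms(1) by (simp add: in_X)
  ultimately show ?case using p_1[of n] by metis
qed (use assms(2) in simp)

lemma eventually_neq_1:
  assumes "x \<in> topspace X" "x \<noteq> (\<lambda>_. 1)"
  obtains m where "\<And>n. m \<le> n \<Longrightarrow> x n \<noteq> 1"
proof -
  obtain m where "x m \<noteq> 1" using assms(2) by (auto simp: fun_eq_iff)
  then show ?thesis using neq_1_above[OF assms(1)] that by blast
qed

text \<open>At every sufficiently high level \<open>x\<close> lies inside the loop, away from the base point 1, and its
  orbit runs through the whole loop.\<close>

lemma dense_orbit:
  assumes x: "x \<in> topspace X" and "f x \<noteq> x"
  shows "X closure_of (range (\<lambda>i. int_iterate X f i x)) = topspace X"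
proof (intro equalityI closure_of_subset_topspace subsetI)
  fix y assume y: "y \<in> topspace X"
  obtain m where m: "\<And>n. m \<le> n \<Longrightarrow> x n \<noteq> 1"
    using eventually_neq_1[OF x] assms(2) f_fixed_iff[OF x] by blast
  have "\<exists>z. z \<in> range (\<lambda>i. int_iterate X f i x) \<and> z \<in> T" if T: "y \<in> T" "openin X T" for T
  proof -
    obtain n where n: "m \<le> n" and sub: "{z \<in> topspace X. z n = y n} \<subseteq> T"
      by (rule X_cylinder_within_open[OF T(2,1)])
    have "1 \<le> x n" and yn: "1 \<le> y n" "y n \<le> N n"
      using x y by (auto simp: in_X)
    with m[OF n] have xn: "2 \<le> x n" by linarith
    show ?thesis
    proof (cases "x n \<le> y n")
      case True
      let ?k = "y n - x n"
      have "int_iterate X f (int ?k) x = (f ^^ ?k) x" by (simp add: int_iterate_def)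
      moreover have "(f ^^ ?k) x n = y n"
        using funpow_f_coordinate[OF x xn, of ?k] True yn by simp
      ultimately have "int_iterate X f (int ?k) x \<in> T" using sub funpow_f_in[OF x] by auto
      then show ?thesis by blast
    next
      case False
      define k where "k = x n - y n"
      have k: "0 < k" "k < x n" "x n - k = y n" using False yn by (auto simp: k_def)
      have "int_iterate X f (- int k) x = (f_inv ^^ k) x"
        using k(1) by (simp add: int_iterate_def)
      moreover have "(f_inv ^^ k) x \<in> topspace X" "(f_inv ^^ k) x n = y n"
        using funpow_f_inv_coordinate[OF x k(2)] k(3) by auto
      ultimately have "int_iterate X f (- int k) x \<in> T" using sub by auto
      then show ?thesis by blast
    qed
  qed
  then show "y \<in> X closure_of (range (\<lambda>i. int_iterate X f i x))"
    using y by (simp add: in_closure_of)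
qed

theorem f_in_homeos_one_fixpoint: "f \<in> homeos_one_fixpoint X"
proof -
  have "\<exists>!x. x \<in> topspace X \<and> f x = x"
    using const_1_in f_fixed_iff by metis
  moreover have "f \<in> extensional (topspace X)"
    by (simp add: shim_map_def)
  ultimately show ?thesis
    unfolding homeos_one_fixpoint_def using homeomorphic_f dense_orbit by blast
qed

section \<open>Mixing from the distances between occurrences of a loop\<close>

text \<open>The vertex 2 serves as the marker of a passage through the loop: unlike 1, it occurs exactly
  once in each passage, and never while a point waits at the base point.\<close>

definition return_times :: "nat \<Rightarrow> nat set" where
  "return_times n = {k. \<exists>x\<in>topspace X. x n = 2 \<and> (f ^^ k) x n = 2}"

lemma funpow_funpow: "(f ^^ a) ((f ^^ b) x) = (f ^^ (a + b)) x"
  by (simp add: funpow_add)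

lemma zero_in_return_times: "1 \<le> n \<Longrightarrow> 0 \<in> return_times n"
  using N_ge[of n] point_through_vertex[of 2 n] by (auto simp: return_times_def)

text \<open>Here \<open>2 + c\<close> and \<open>2 + d\<close> are two places of the loop at level \<open>Suc n\<close> where a letter \<open>L\<close> of the
  word passes through 2. Moving the start to the first place and the end to the second changes the
  time by \<open>d - c\<close>.\<close>

lemma return_times_descend:
  assumes k: "k \<in> return_times (Suc n)"
    and c: "2 + c \<le> N (Suc n)" "p n (2 + c) = 2" and d: "2 + d \<le> N (Suc n)" "p n (2 + d) = 2"
    and eq: "k + d = l + c"
  shows "l \<in> return_times n"
proof -
  obtain x where x: "x \<in> topspace X" "x (Suc n) = 2" "(f ^^ k) x (Suc n) = 2"
    using k by (auto simp: return_times_def)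
  let ?u = "(f ^^ c) x" and ?v = "(f ^^ d) ((f ^^ k) x)"
  have "?u (Suc n) = 2 + c" "?v (Suc n) = 2 + d"
    using x c d by (simp_all add: funpow_f_coordinate)
  moreover have "?u \<in> topspace X" "?v \<in> topspace X" using x by auto
  ultimately have "?u n = 2" "?v n = 2"
    using c d unfolding in_X by metis+
  moreover have "?v = (f ^^ l) ?u"
    unfolding funpow_funpow using eq by (simp add: add.commute)
  ultimately show ?thesis
    using \<open>?u \<in> topspace X\<close> unfolding return_times_def by auto
qed

text \<open>The time \<open>c\<close> must be the same for all points, so that it can be fixed before the return time is
  chosen. The base point is reached at the end of the loop.\<close>

lemma reaches_vertex_from_2:
  assumes n: "1 \<le> n" and a: "1 \<le> a" "a \<le> N n"
  obtains c where "\<And>x. x \<in> topspace X \<Longrightarrow> x n = 2 \<Longrightarrow> (f ^^ c) x n = a"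
proof (cases "a = 1")
  case True
  have "(f ^^ Suc (N n - 2)) x n = a" if x: "x \<in> topspace X" "x n = 2" for x
  proof -
    let ?y = "(f ^^ (N n - 2)) x"
    have "?y n = N n" using funpow_f_coordinate[OF x(1), of n "N n - 2"] x N_ge[OF n] by simp
    then have "f ?y n = 1"
      using f_wedge[of ?y n] x(1) N_ge[OF n] by (auto simp: wedge_def)
    then show ?thesis using True by simp
  qed
  then show ?thesis using that by blast
next
  case False
  then show ?thesis
    using that[of "a - 2"] funpow_f_coordinate[of _ n "a - 2"] a by simp
qed

text \<open>Open sets may be replaced by the cylinders over two vertices of one level, and these are reached
  from vertex 2 within fixed times \<open>c\<close> and \<open>d\<close>, so a passage time between the cylinders is a return
  time up to \<open>c - d\<close>.\<close>

lemma mixing_if_return_times_cofinite: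
  assumes cofinite: "\<And>n. 1 \<le> n \<Longrightarrow> \<exists>K. \<forall>k\<ge>K. k \<in> return_times n"
  shows "topologically_mixing X f"
  unfolding topologically_mixing_def
proof (intro allI impI, elim conjE)
  fix U V assume U: "openin X U" "U \<noteq> {}" and V: "openin X V" "V \<noteq> {}"
  obtain u v where uv: "u \<in> U" "v \<in> V" using U(2) V(2) by blast
  then have uvX: "u \<in> topspace X" "v \<in> topspace X"
    using U(1) V(1) openin_subset by blast+
  obtain m where m: "1 \<le> m" "{z \<in> topspace X. z m = u m} \<subseteq> U"
    by (rule X_cylinder_within_open[OF U(1) uv(1)])
  obtain n where n: "m \<le> n" "{z \<in> topspace X. z n = v n} \<subseteq> V"
    by (rule X_cylinder_within_open[OF V(1) uv(2)])
  have "{z \<in> topspace X. z n = u n} \<subseteq> {z \<in> topspace X. z m = u m}"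
    using X_coordinates_below[of _ u n m] uvX n(1) by blast
  with m(2) have sub: "{z \<in> topspace X. z n = u n} \<subseteq> U" by blast
  have n1: "1 \<le> n" using m n by simp
  obtain c where c: "\<And>x. x \<in> topspace X \<Longrightarrow> x n = 2 \<Longrightarrow> (f ^^ c) x n = u n"
    using reaches_vertex_from_2[OF n1, of "u n"] uvX(1) by (auto simp: in_X)
  obtain d where d: "\<And>x. x \<in> topspace X \<Longrightarrow> x n = 2 \<Longrightarrow> (f ^^ d) x n = v n"
    using reaches_vertex_from_2[OF n1, of "v n"] uvX(2) by (auto simp: in_X)
  obtain K where K: "\<And>k. K \<le> k \<Longrightarrow> k \<in> return_times n" using cofinite[OF n1] by blast
  have "(f ^^ k) ` U \<inter> V \<noteq> {}" if k: "K + d \<le> k" for k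
  proof -
    have "k + c - d \<in> return_times n" using k by (intro K) simp
    then obtain x where x: "x \<in> topspace X" "x n = 2" "(f ^^ (k + c - d)) x n = 2"
      by (auto simp: return_times_def)
    have "(f ^^ c) x \<in> U" using sub c[OF x(1,2)] x(1) by auto
    moreover have "(f ^^ d) ((f ^^ (k + c - d)) x) \<in> V"
      using n(2) d[of "(f ^^ (k + c - d)) x"] x by auto
    moreover have "(f ^^ d) ((f ^^ (k + c - d)) x) = (f ^^ k) ((f ^^ c) x)"
      unfolding funpow_funpow using k by simp
    ultimately show ?thesis by auto
  qed
  then show "\<exists>N. \<forall>k\<ge>N. (f ^^ k) ` U \<inter> V \<noteq> {}" by blast
qed

section \<open>A parity obstruction to weak mixing\<close>

text \<open>The first \<open>k\<close> points of the orbit of a point other than the fixed point avoid the base point at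
  all high levels. There the \<open>k\<close> steps stay within one passage through the loop, and time becomes the
  difference of coordinates.\<close>

lemma eventually_funpow_coordinate:
  assumes x: "x \<in> topspace X" "x \<noteq> (\<lambda>_. 1)"
  shows "\<exists>m. \<forall>n\<ge>m. (f ^^ k) x n = x n + k"
proof (induction k)
  case (Suc k)
  then obtain m where m: "\<forall>n\<ge>m. (f ^^ k) x n = x n + k" by blast
  have "f (\<lambda>_. 1) = (\<lambda>_. 1)" using f_fixed_iff[OF const_1_in] by simp
  then have "(f ^^ j) (\<lambda>_. 1) = (\<lambda>_. 1)" for j by (induction j) auto
  moreover have "inj_on (f ^^ j) (topspace X)" for j
    using bij_betw_funpow[OF bij_betw_f, of j] by (simp add: bij_betw_def)
  ultimately have "(f ^^ Suc k) x \<noteq> (\<lambda>_. 1)"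
    using x const_1_in by (metis inj_onD)
  then obtain m' where m': "\<And>n. m' \<le> n \<Longrightarrow> (f ^^ Suc k) x n \<noteq> 1"
    using eventually_neq_1[OF funpow_f_in[OF x(1), of "Suc k"]] by blast
  have "(f ^^ Suc k) x n = x n + Suc k" if "max m m' \<le> n" for n
    using wedge_backward[OF f_wedge[OF funpow_f_in[OF x(1), of k], of n]] m m'[of n] that by simp
  then show ?case by blast
qed simp

text \<open>Under the hypothesis the parity of a coordinate alternates from level to level, starting from
  the parity at level 1. Comparing two points of an orbit at a level so high that time is the
  difference of coordinates, the time between their vertices at level 1 has the parity of the
  difference of these vertices.\<close>

lemma not_weak_mixing_if_parity_shift:
  assumes parity: "\<And>n i. 1 \<le> i \<Longrightarrow> i \<le> N (Suc n) \<Longrightarrow> p n i \<noteq> 1 \<Longrightarrow> odd (i + p n i)"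
  shows "\<not> weak_mixing X f"
proof
  have coordinate_parity: "even (x (Suc n) + x 1 + n)" if x: "x \<in> topspace X" "x 1 \<noteq> 1" for x n
  proof (induction n)
    case (Suc n)
    have "x (Suc n) \<noteq> 1" using neq_1_above[OF x, of "Suc n"] by simp
    moreover have "1 \<le> x (Suc (Suc n))" "x (Suc (Suc n)) \<le> N (Suc (Suc n))"
        "p (Suc n) (x (Suc (Suc n))) = x (Suc n)"
      using x(1) unfolding in_X by blast+
    ultimately have "odd (x (Suc (Suc n)) + x (Suc n))"
      using parity[of "x (Suc (Suc n))" "Suc n"] by simp
    with Suc show ?case by auto
  qed simp
  have time_parity: "even (k + x 1 + (f ^^ k) x 1)"
    if x: "x \<in> topspace X" "x 1 \<noteq> 1" "(f ^^ k) x 1 \<noteq> 1" for x k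
  proof -
    obtain m where "\<forall>n\<ge>m. (f ^^ k) x n = x n + k"
      using eventually_funpow_coordinate[OF x(1)] x(2) by blast
    then have "(f ^^ k) x (Suc m) = x (Suc m) + k" by simp
    moreover have "even (x (Suc m) + x 1 + m)" "even ((f ^^ k) x (Suc m) + (f ^^ k) x 1 + m)"
      using coordinate_parity x by simp_all
    ultimately show ?thesis by simp presburger
  qed
  define C where "C a = {z \<in> topspace X. z 1 = a}" for a
  have C: "openin X (C a)" for a
    unfolding C_def by (rule X_openin_cylinder)
  have ne: "C a \<noteq> {}" if "1 \<le> a" "a \<le> 3" for a
  proof -
    have "a \<le> N 1" using N_ge[of 1] that(2) by linarith
    with that(1) obtain z where "z \<in> topspace X" "z 1 = a" by (rule point_through_vertex)
    then show ?thesis by (auto simp: C_def)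
  qed
  \<comment> \<open>A time from \<open>C 2\<close> to \<open>C 2\<close> is even, one from \<open>C 2\<close> to \<open>C 3\<close> is odd.\<close>
  assume "weak_mixing X f"
  moreover have "openin (prod_topology X X) (C a \<times> C b)" for a b
    using C by (simp add: openin_prod_Times_iff)
  moreover have "C 2 \<times> C 2 \<noteq> {}" "C 2 \<times> C 3 \<noteq> {}"
    using ne by simp_all
  ultimately have "\<exists>k\<ge>1. (map_prod f f ^^ k) ` (C 2 \<times> C 2) \<inter> (C 2 \<times> C 3) \<noteq> {}"
    unfolding weak_mixing_def topologically_transitive_def by simp
  then obtain k where "(map_prod f f ^^ k) ` (C 2 \<times> C 2) \<inter> (C 2 \<times> C 3) \<noteq> {}"
    by (elim exE conjE)
  then obtain z' where z': "z' \<in> (map_prod f f ^^ k) ` (C 2 \<times> C 2)" "z' \<in> C 2 \<times> C 3"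
    by (meson disjoint_iff)
  from z'(1) obtain z where "z' = (map_prod f f ^^ k) z" "z \<in> C 2 \<times> C 2"
    by (rule imageE)
  moreover note z'(2)
  moreover have "(map_prod f f ^^ k) z = ((f ^^ k) (fst z), (f ^^ k) (snd z))" for z
    by (induction k) auto
  ultimately obtain x y where "x \<in> C 2" "y \<in> C 2" "(f ^^ k) x \<in> C 2" "(f ^^ k) y \<in> C 3"
    by (metis mem_Times_iff fst_conv snd_conv)
  then have "even (k + 2 + 2)" "even (k + 2 + 3)"
    using time_parity[of x k] time_parity[of y k] by (auto simp: C_def)
  then show False by simp
qed

end

section \<open>The four words\<close>

lemma word_map_eq:
  assumes "word_values w n = xs @ a # ys" "i = Suc (length xs)"
  shows "word_map w n i = a"
proof -
  have "i \<le> ell w n" using assms by (simp flip: length_word_values)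
  then show ?thesis using assms by (simp add: word_map_def nth_append)
qed

lemma digits_from_2: "2 \<le> n \<Longrightarrow> [1..<Suc n] = 1 # 2 # [3..<Suc n]"
  by (simp add: upt_conv_Cons numeral_2_eq_2 numeral_3_eq_3 del: upt_Suc)

text \<open>All times from the length of the loop on are return times. The induction is on the excess \<open>s\<close> over
  this length, over all levels together: passing to the next level lowers it by 2.\<close>

lemma mixing_eLeLLe:
  assumes "w = [E, L, E, L, L, E]"
  shows "topologically_mixing (shim_space (\<lambda>_. w)) (shim_map (\<lambda>_. w))"
proof -
  interpret word_sequence "\<lambda>_. w"
    using assms by unfold_locales (simp add: S'_def)
  have NS: "N (Suc n) = 3 * N n + 3" for n
    by (simp add: assms ell_def)
  have at: "p n (2 + 1) = 2" "p n (2 + (N n + 2)) = 2" "p n (2 + (2 * N n + 2)) = 2" if "1 \<le> n" for n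
  proof -
    let ?l = "[1..<Suc (N n)]"
    have v: "word_values w (N n) = [1] @ ?l @ [1] @ ?l @ ?l @ [1]"
      by (simp add: assms word_values_def)
    have l: "?l = 1 # 2 # [3..<Suc (N n)]"
      using N_ge[OF that] by (intro digits_from_2) simp
    show "p n (2 + 1) = 2" unfolding shim_p_def
      by (rule word_map_eq[where xs = "[1, 1]"]) (subst v, subst l, simp_all)
    show "p n (2 + (N n + 2)) = 2" unfolding shim_p_def
      by (rule word_map_eq[where xs = "[1] @ ?l @ [1, 1]"]) (subst v, subst (2) l, simp_all)
    show "p n (2 + (2 * N n + 2)) = 2" unfolding shim_p_def
      by (rule word_map_eq[where xs = "[1] @ ?l @ [1] @ ?l @ [1]"]) (subst v, subst (3) l, simp_all)
  qed
  have "N n + s \<in> return_times n" if "1 \<le> n" for n s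
    using that
  proof (induction s arbitrary: n rule: less_induct)
    case (less s)
    have zero: "0 \<in> return_times (Suc n)" by (rule zero_in_return_times) simp
    consider "s = 0" | "s = 1" | t where "s = t + 2"
      by (metis add_2_eq_Suc' not0_implies_Suc One_nat_def)
    then show ?case
    proof cases
      case 1
      show ?thesis
        by (rule return_times_descend[OF zero, of "N n + 2" "2 * N n + 2"])
          (use at[OF less.prems] NS[of n] N_pos[of n] 1 in simp_all)
    next
      case 2
      show ?thesis
        by (rule return_times_descend[OF zero, of 1 "N n + 2"])
          (use at[OF less.prems] NS[of n] N_pos[of n] 2 in simp_all)
    next
      case 3
      then have "N (Suc n) + t \<in> return_times (Suc n)" by (intro less.IH) simp_all
      then show ?thesis
        by (rule return_times_descend[of _ n "2 * N n + 2" 1])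
          (use at[OF less.prems] NS[of n] N_pos[of n] 3 in simp_all)
    qed
  qed
  then have "k \<in> return_times n" if "1 \<le> n" "N n \<le> k" for n k
    using that by (metis le_add_diff_inverse)
  then show ?thesis
    by (intro mixing_if_return_times_cofinite) blast
qed

text \<open>The step from the last \<open>L\<close> of a loop to the first \<open>L\<close> of a later one again lowers the excess over
  the length of the loop by 2 at the next level, but now the base case 1 is missing: only even
  excesses arise this way. For an odd excess \<open>k - N n\<close>, the time \<open>k + N n\<close> exceeds \<open>N (Suc n)\<close> by an
  even number, since lengths are odd; descending from the second \<open>L\<close> to the first subtracts \<open>N n\<close>
  again. This needs \<open>k + N n\<close> to be at least \<open>N (Suc n)\<close>, whence the bound \<open>2 * N n + 2\<close>.\<close>

lemma mixing_eLLLe: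
  assumes "w = [E, L, L, L, E]"
  shows "topologically_mixing (shim_space (\<lambda>_. w)) (shim_map (\<lambda>_. w))"
proof -
  interpret word_sequence "\<lambda>_. w"
    using assms by unfold_locales (simp add: S'_def)
  have NS: "N (Suc n) = 3 * N n + 2" for n
    by (simp add: assms ell_def)
  have odd_N: "odd (N n)" for n
    by (induction n) (simp, simp add: NS del: shim_N.simps)
  have at: "p n (2 + 1) = 2" "p n (2 + (N n + 1)) = 2" "p n (2 + (2 * N n + 1)) = 2" if "1 \<le> n" for n
  proof -
    let ?l = "[1..<Suc (N n)]"
    have v: "word_values w (N n) = [1] @ ?l @ ?l @ ?l @ [1]"
      by (simp add: assms word_values_def)
    have l: "?l = 1 # 2 # [3..<Suc (N n)]"
      using N_ge[OF that] by (intro digits_from_2) simp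
    show "p n (2 + 1) = 2" unfolding shim_p_def
      by (rule word_map_eq[where xs = "[1, 1]"]) (subst v, subst l, simp_all)
    show "p n (2 + (N n + 1)) = 2" unfolding shim_p_def
      by (rule word_map_eq[where xs = "[1] @ ?l @ [1]"]) (subst v, subst (2) l, simp_all)
    show "p n (2 + (2 * N n + 1)) = 2" unfolding shim_p_def
      by (rule word_map_eq[where xs = "[1] @ ?l @ ?l @ [1]"]) (subst v, subst (3) l, simp_all)
  qed
  have even_excess: "N n + 2 * s \<in> return_times n" if "1 \<le> n" for n s
    using that
  proof (induction s arbitrary: n)
    case 0
    have "0 \<in> return_times (Suc n)" by (rule zero_in_return_times) simp
    then show ?case
      by (rule return_times_descend[of 0 n 1 "N n + 1"]) (use at[OF 0] NS[of n] N_pos[of n] in simp_all)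
  next
    case (Suc s)
    have "N (Suc n) + 2 * s \<in> return_times (Suc n)" by (rule Suc.IH) simp
    then show ?case
      by (rule return_times_descend[of _ n "2 * N n + 1" 1])
        (use at[OF Suc.prems] NS[of n] N_pos[of n] in simp_all)
  qed
  have "k \<in> return_times n" if n: "1 \<le> n" and k: "2 * N n + 2 \<le> k" for n k
  proof (cases "even (k + N n)")
    case True
    then have "even (k - N n)" using k by simp
    then obtain s where "k - N n = 2 * s" by blast
    with k have "k = N n + 2 * s" by simp
    then show ?thesis using even_excess[OF n] by simp
  next
    case False
    then have "even (k + N n - N (Suc n))"
      using odd_N[of "Suc n"] k NS[of n] by simp
    then obtain s where "k + N n - N (Suc n) = 2 * s" by blast
    with k have "k + N n = N (Suc n) + 2 * s" by (simp add: NS del: shim_N.simps)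
    then have "k + N n \<in> return_times (Suc n)" using even_excess[of "Suc n" s] by simp
    then show ?thesis
      by (rule return_times_descend[of _ n "N n + 1" 1]) (use at[OF n] NS[of n] N_pos[of n] in simp_all)
  qed
  then show ?thesis
    by (intro mixing_if_return_times_cofinite) blast
qed

text \<open>The first \<open>L\<close> is preceded by one digit, the second by \<open>n + 1\<close> digits in \<open>eLLe\<close> and by \<open>n + 2\<close> in
  \<open>eLeLe\<close>. The stated parities of \<open>n\<close> make all of these shifts odd.\<close>

lemma word_map_parity:
  assumes "w = [E, L, L, E] \<and> even n \<or> w = [E, L, E, L, E] \<and> odd n"
    and "1 \<le> i" "i \<le> ell w n" "word_map w n i \<noteq> 1"
  shows "odd (i + word_map w n i)"
proof -
  obtain q where q: "i = Suc q" using assms(2) by (cases i) auto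
  have val: "word_map w n i = word_values w n ! q"
    using assms(2,3) q by (simp add: word_map_def)
  have bounds: "q < ell w n" "word_values w n ! q \<noteq> 1"
    using assms(3,4) q val by simp_all
  from assms(1) show ?thesis
  proof
    assume w: "w = [E, L, L, E] \<and> even n"
    then have "word_values w n = [1] @ [1..<Suc n] @ [1..<Suc n] @ [1]"
      by (simp add: word_values_def)
    then have "word_values w n ! q = q \<or> n < q \<and> word_values w n ! q = q - n"
      using bounds w by (auto simp: nth_append nth_Cons' ell_def simp del: upt_Suc split: if_splits)
    then show ?thesis unfolding val using w q by auto
  next
    assume w: "w = [E, L, E, L, E] \<and> odd n"
    then have "word_values w n = [1] @ [1..<Suc n] @ [1] @ [1..<Suc n] @ [1]"
      by (simp add: word_values_def)
    then have "word_values w n ! q = q \<or> Suc n < q \<and> word_values w n ! q = q - Suc n"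
      using bounds w by (auto simp: nth_append nth_Cons' ell_def simp del: upt_Suc split: if_splits)
    then show ?thesis unfolding val using w q by auto
  qed
qed

lemma not_weak_mixing_eLLe_eLeLe:
  assumes "w = [E, L, L, E] \<or> w = [E, L, E, L, E]"
  shows "\<not> weak_mixing (shim_space (\<lambda>_. w)) (shim_map (\<lambda>_. w))"
proof -
  interpret word_sequence "\<lambda>_. w"
    using assms by unfold_locales (auto simp: S'_def)
  have w_in: "w \<in> S'" using ws .
  show ?thesis
  proof (rule not_weak_mixing_if_parity_shift)
    fix n i
    assume i: "1 \<le> i" "i \<le> N (Suc n)" "p n i \<noteq> 1"
    \<comment> \<open>The loop at level 0 has the odd length 1, but it has no vertex other than 1. From level 1 on
      the length is even for \<open>eLLe\<close>.\<close>
    have "n \<noteq> 0"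
    proof
      assume "n = 0"
      then have "p n i \<in> {1..1}"
        using word_map_surj[OF w_in, of 1] i(1,2) by (auto simp: shim_p_def)
      then show False using i(3) by simp
    qed
    moreover have "odd (N n)" if "w = [E, L, E, L, E]" for n
      by (induction n) (simp_all add: that ell_def)
    ultimately have "w = [E, L, L, E] \<and> even (N n) \<or> w = [E, L, E, L, E] \<and> odd (N n)"
      using assms by (cases n) (auto simp: ell_def)
    then show "odd (i + p n i)"
      unfolding shim_p_def
      by (rule word_map_parity) (use i in \<open>simp_all add: shim_p_def\<close>)
  qed
qed

theorem theorem4p19:
  fixes w :: "letter list"
  assumes "w \<in> S'"
  shows "let ws = (\<lambda>n::nat. w); X = shim_space ws; f = shim_map ws in
           shim_rel ws = {(x, f x) | x. x \<in> topspace X} \<and>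
           f \<in> homeos_one_fixpoint X \<and>
           (w = [E, L, E, L, L, E] \<or> w = [E, L, L, L, E] \<longrightarrow> topologically_mixing X f) \<and>
           (w = [E, L, L, E] \<or> w = [E, L, E, L, E] \<longrightarrow> \<not> weak_mixing X f)"
proof -
  interpret word_sequence "\<lambda>_. w"
    using assms by unfold_locales
  have "shim_rel (\<lambda>_. w) = {(x, f x) | x. x \<in> topspace X}"
    by (auto simp: shim_rel_iff)
  then show ?thesis
    unfolding Let_def
    using f_in_homeos_one_fixpoint mixing_eLeLLe mixing_eLLLe not_weak_mixing_eLLe_eLeLe by blast
qed

end
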